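(* Let $n\geq 10$ and let $C\subseteq\mathbb{F}^n$ be a locating-dominating code. After applying Rule 1 to the shares, every codeword $\mathbf{c}\in C$ has share $s(\mathbf{c})\leq \frac{n}{2}+1$.
   Context: $\mathbb{F}^n$ is the binary Hamming space: the set of binary words of length $n$ with the Hamming distance $d$; two words are adjacent if they are at distance $1$. $N(\mathbf{u})$ is the set of words at distance $1$ from $\mathbf{u}$ and $N[\mathbf{u}]=N(\mathbf{u})\cup\{\mathbf{u}\}$. A code is a nonempty subset $C\subseteq\mathbb{F}^n$; $I(\mathbf{u})=C\cap N[\mathbf{u}]$. $C$ is locating-dominating if $I(\mathbf{u})\neq\emptyset$ for all words $\mathbf{u}$ and $I(\mathbf{u})\neq I(\mathbf{v})$ for all distinct non-codewords $\mathbf{u},\mathbf{v}$. The (initial) share of a codeword $\mathbf{c}$ is $s(\mathbf{c})=\sum_{\mathbf{v}\in N[\mathbf{c}]}1/|I(\mathbf{v})|$. A father is a word $\mathbf{u}$ with $|I(\mathbf{u})|\geq 3$. A son is a word $\mathbf{x}$ with $|I(\mathbf{x})|=2$ and $I(\mathbf{x})\subseteq I(\mathbf{u})$ for some father $\mathbf{u}$. An orphan is a non-codeword $\mathbf{x}$ with $|I(\mathbf{x})|=1$. A codeword $\mathbf{c}$ is special if $I(\mathbf{c})=\{\mathbf{c}\}$, $N(\mathbf{c})$ contains exactly one orphan and exactly $n-2$ sons. A special father is a father adjacent to some special codeword. For a special father $\mathbf{u}$, let $C'(\mathbf{u})$ be the set of codewords $\mathbf{c}'\in I(\mathbf{u})$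 such that $\mathbf{u}$ is the only special father in $N[\mathbf{c}']$ (these sets are pairwise disjoint for distinct special fathers). Rule 1: for every special father $\mathbf{u}$, the share of each codeword in $C'(\mathbf{u})$ is replaced by the average $\frac{1}{|C'(\mathbf{u})|}\sum_{\mathbf{a}\in C'(\mathbf{u})}s(\mathbf{a})$; codewords lying in no set $C'(\mathbf{u})$ keep their share. *)

theory Defs
  imports Complex_Main "HOL-Library.Cardinality"
begin

text \<open>
  A binary word of length \<open>n\<close> is a function \<open>'n \<Rightarrow> bool\<close> on a finite index type
  with \<open>CARD('n) = n\<close>, so the whole Hamming space is the universe of this type.
\<close>

type_synonym 'n bword = "'n \<Rightarrow> bool"

definition hamming_dist :: "'n::finite bword \<Rightarrow> 'n bword \<Rightarrow> nat" where
  "hamming_dist u v = card {i. u i \<noteq> v i}"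

definition nbhd :: "'n::finite bword \<Rightarrow> 'n bword set" where
  "nbhd u = {v. hamming_dist u v = 1}"

definition closed_nbhd :: "'n::finite bword \<Rightarrow> 'n bword set" where
  "closed_nbhd u = nbhd u \<union> {u}"

definition I_set :: "'n::finite bword set \<Rightarrow> 'n bword \<Rightarrow> 'n bword set" where
  "I_set C u = C \<inter> closed_nbhd u"

definition locating_dominating :: "'n::finite bword set \<Rightarrow> bool" where
  "locating_dominating C \<longleftrightarrow>
     C \<noteq> {} \<and>
     (\<forall>u. I_set C u \<noteq> {}) \<and>
     (\<forall>u v. u \<notin> C \<longrightarrow> v \<notin> C \<longrightarrow> u \<noteq> v \<longrightarrow> I_set C u \<noteq> I_set C v)"

definition share :: "'n::finite bword set \<Rightarrow> 'n bword \<Rightarrow> real" where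
  "share C c = (\<Sum>v\<in>closed_nbhd c. 1 / real (card (I_set C v)))"

definition father :: "'n::finite bword set \<Rightarrow> 'n bword \<Rightarrow> bool" where
  "father C u \<longleftrightarrow> card (I_set C u) \<ge> 3"

definition son :: "'n::finite bword set \<Rightarrow> 'n bword \<Rightarrow> bool" where
  "son C x \<longleftrightarrow> card (I_set C x) = 2 \<and> (\<exists>u. father C u \<and> I_set C x \<subseteq> I_set C u)"

definition orphan :: "'n::finite bword set \<Rightarrow> 'n bword \<Rightarrow> bool" where
  "orphan C x \<longleftrightarrow> x \<notin> C \<and> card (I_set C x) = 1"

definition special_codeword :: "'n::finite bword set \<Rightarrow> 'n bword \<Rightarrow> bool" where
  "special_codeword C c \<longleftrightarrow>
     c \<in> C \<and> I_set C c = {c} \<and>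
     card {x \<in> nbhd c. orphan C x} = 1 \<and>
     card {x \<in> nbhd c. son C x} = CARD('n) - 2"

definition special_father :: "'n::finite bword set \<Rightarrow> 'n bword \<Rightarrow> bool" where
  "special_father C u \<longleftrightarrow> father C u \<and> (\<exists>c. special_codeword C c \<and> u \<in> nbhd c)"

definition C' :: "'n::finite bword set \<Rightarrow> 'n bword \<Rightarrow> 'n bword set" where
  "C' C u = {c' \<in> I_set C u. {w \<in> closed_nbhd c'. special_father C w} = {u}}"

lemma C'_disjoint: "u \<noteq> v \<Longrightarrow> C' C u \<inter> C' C v = {}"
  by (auto simp: C'_def)

text \<open>
  By disjointness of the sets \<open>C' C u\<close>, the description in the first branch is
  well defined; all averages are taken over the initial shares.
\<close>

definition share_rule1 :: "'n::finite bword set \<Rightarrow> 'n bword \<Rightarrow> real" where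
  "share_rule1 C c =
     (if \<exists>u. special_father C u \<and> c \<in> C' C u
      then let u = (THE u. special_father C u \<and> c \<in> C' C u)
           in (\<Sum>a\<in>C' C u. share C a) / real (card (C' C u))
      else share C c)"

lemma share_rule1_average:
  assumes "special_father C u" "c \<in> C' C u"
  shows "share_rule1 C c = (\<Sum>a\<in>C' C u. share C a) / real (card (C' C u))"
proof -
  have "(THE w. special_father C w \<and> c \<in> C' C w) = u"
    using assms C'_disjoint by (intro the_equality) blast+
  then show ?thesis
    using assms unfolding share_rule1_def Let_def by auto
qed

lemma share_rule1_unchanged:
  assumes "\<And>u. special_father C u \<Longrightarrow> c \<notin> C' C u"
  shows "share_rule1 C c = share C c"
  using assms by (auto simp: share_rule1_def)

end

theory Submission
  imports Defs
begin

text \<open>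
  In \<open>N[c]\<close> only \<open>c\<close> itself and at most one orphan can contribute 1 to the share of \<open>c\<close>, so the
  bound can fail only if \<open>I(c) = {c}\<close> and there is an orphan. Then a neighbour \<open>x\<close> with
  \<open>I(x) = {c, c'}\<close> forces the second common neighbour of \<open>c\<close> and \<open>c'\<close> to be a father, so the
  fathers \<open>u\<close> around \<open>c\<close> account for at most the sum of the \<open>|I(u)| - 1\<close> sons. For \<open>n \<ge> 10\<close> two or
  more fathers lower the share sufficiently, and with a single father \<open>u\<close> the codeword is special,
  its excess is \<open>1/|I(u)|\<close>, and all neighbours of \<open>u\<close> but one are codewords. The exceptional
  neighbour is dominated by a codeword adjacent to some \<open>a \<in> C'(u)\<close>; the share of \<open>a\<close> is smaller than
  the bound by at least \<open>1 - 1/|I(u)|\<close>, which pays for all the other codewords in \<open>C'(u)\<close>.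
\<close>

section \<open>Neighbours as coordinate flips\<close>

definition flip :: "'n bword \<Rightarrow> 'n \<Rightarrow> 'n bword" where
  "flip u i = u(i := \<not> u i)"

lemma flip_flip_same [simp]: "flip (flip u i) i = u"
  by (simp add: flip_def fun_eq_iff)

lemma flip_commute: "flip (flip u i) j = flip (flip u j) i"
  by (auto simp: flip_def fun_eq_iff)

lemma flip_neq [simp]: "flip u i \<noteq> u" "u \<noteq> flip u i"
  by (auto simp: flip_def fun_eq_iff)

lemma flip_eq_iff [simp]: "flip u i = flip u j \<longleftrightarrow> i = j"
  by (auto simp: flip_def fun_eq_iff)

lemma flip_flip_eq_iff [simp]: "flip (flip u i) j = u \<longleftrightarrow> i = j"
  by (auto simp: flip_def fun_eq_iff)

lemma flip_inj_on [simp]: "inj_on (flip u) A"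
  by (auto simp: inj_on_def)

text \<open>Together with \<open>flip_inj_on\<close> this indexes neighbours by coordinates, so
  counts and share sums over neighbourhoods become counts and sums over \<open>'n\<close>.\<close>

lemma nbhd_eq_range_flip: "nbhd u = range (flip u)"
proof (intro equalityI subsetI)
  fix v assume "v \<in> nbhd u"
  then obtain i where i: "{i. u i \<noteq> v i} = {i}"
    by (auto simp: nbhd_def hamming_dist_def card_1_singleton_iff)
  have "v = flip u i"
  proof
    fix j
    have "u j \<noteq> v j \<longleftrightarrow> j = i" using i by blast
    then show "v j = flip u i j" by (auto simp: flip_def)
  qed
  then show "v \<in> range (flip u)" by simp
next
  fix v assume "v \<in> range (flip u)"
  then obtain i where "v = flip u i" by blast
  then have "{i. u i \<noteq> v i} = {i}" by (auto simp: flip_def)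
  then show "v \<in> nbhd u" by (simp add: nbhd_def hamming_dist_def)
qed

lemma card_nbhd_Collect: "card {x \<in> nbhd u. P x} = card {i. P (flip u i)}"
proof -
  have "{x \<in> nbhd u. P x} = flip u ` {i. P (flip u i)}"
    by (auto simp: nbhd_eq_range_flip)
  then show ?thesis by (simp add: card_image)
qed

lemma I_set_eq: "I_set C u = (if u \<in> C then {u} else {}) \<union> flip u ` {i. flip u i \<in> C}"
  by (auto simp: I_set_def closed_nbhd_def nbhd_eq_range_flip)

lemma card_I_set: "card (I_set C u) = (if u \<in> C then 1 else 0) + card {i. flip u i \<in> C}"
proof -
  have "u \<notin> flip u ` {i. flip u i \<in> C}" by auto
  then show ?thesis by (simp add: I_set_eq card_image)
qed

lemma I_set_singleton_iff: "c \<in> C \<Longrightarrow> I_set C c = {c} \<longleftrightarrow> (\<forall>i. flip c i \<notin> C)"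
  by (auto simp: I_set_eq)

lemma share_eq:
  "share C c = 1 / real (card (I_set C c)) + (\<Sum>i\<in>UNIV. 1 / real (card (I_set C (flip c i))))"
proof -
  have "closed_nbhd c = insert c (range (flip c))" "c \<notin> range (flip c)"
    by (auto simp: closed_nbhd_def nbhd_eq_range_flip)
  then show ?thesis by (simp add: share_def sum.reindex)
qed

lemma inverse_le_half: "k \<ge> 2 \<Longrightarrow> 1 / real k \<le> 1 / 2"
  by (simp add: field_simps)

lemma inverse_le_one: "1 / real k \<le> 1"
  \<comment> \<open>At \<open>k = 0\<close> the quotient is 0 by the convention for
    division.\<close>
  by (cases "k = 0") (auto simp: field_simps)

section \<open>Domination, separation and the easy share bound\<close>

locale ld_code =
  fixes C :: "'n::finite bword set"
  assumes ld: "locating_dominating C"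
begin

abbreviation deg :: "'n bword \<Rightarrow> nat" where
  "deg u \<equiv> card (I_set C u)"

lemma deg_pos: "deg u \<ge> 1"
proof -
  have "I_set C u \<noteq> {}" using ld by (simp add: locating_dominating_def)
  then show ?thesis by (simp add: Suc_le_eq card_gt_0_iff)
qed

lemma separated: "u \<notin> C \<Longrightarrow> v \<notin> C \<Longrightarrow> I_set C u = I_set C v \<Longrightarrow> u = v"
  using ld by (auto simp: locating_dominating_def)

lemma mem_I_set_flip: "c \<in> C \<Longrightarrow> c \<in> I_set C (flip c i)"
  by (auto simp: I_set_eq intro: image_eqI[where x = i])

lemma deg_ge_2: "a \<in> I_set C u \<Longrightarrow> b \<in> I_set C u \<Longrightarrow> a \<noteq> b \<Longrightarrow> deg u \<ge> 2"
  using card_mono[of "I_set C u" "{a, b}"] by simp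

lemma deg_ge_3:
  "a \<in> I_set C u \<Longrightarrow> b \<in> I_set C u \<Longrightarrow> d \<in> I_set C u \<Longrightarrow> a \<noteq> b \<Longrightarrow> a \<noteq> d \<Longrightarrow> b \<noteq> d
    \<Longrightarrow> deg u \<ge> 3"
  using card_mono[of "I_set C u" "{a, b, d}"] by simp

lemma deg_flip_eq_1:
  assumes "c \<in> C" "deg (flip c i) = 1"
  shows "I_set C (flip c i) = {c}" "flip c i \<notin> C"
proof -
  show 1: "I_set C (flip c i) = {c}"
    using assms mem_I_set_flip[of c i] by (auto simp: card_1_singleton_iff)
  show "flip c i \<notin> C"
  proof
    assume "flip c i \<in> C"
    then have "flip c i \<in> I_set C (flip c i)" by (simp add: I_set_eq)
    then show False using 1 by simp
  qed
qed

text \<open>Both neighbours would be non-codewords with identifying set \<open>{c}\<close>, against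
  separation.\<close>

lemma deg_flip_eq_1_unique:
  assumes "c \<in> C" "deg (flip c i) = 1" "deg (flip c j) = 1"
  shows "i = j"
  using deg_flip_eq_1[OF assms(1,2)] deg_flip_eq_1[OF assms(1,3)]
    separated[of "flip c i" "flip c j"] by simp

text \<open>Of the n + 1 terms of the share, at most one can exceed 1/2 under this hypothesis, and
  that one is at most 1.\<close>

lemma share_le_if_not_both:
  assumes c: "c \<in> C" and "deg c \<noteq> 1 \<or> (\<forall>i. deg (flip c i) \<noteq> 1)"
  shows "share C c \<le> real CARD('n) / 2 + 1"
proof (cases "\<forall>i. deg (flip c i) \<noteq> 1")
  case True
  then have "deg (flip c i) \<ge> 2" for i
    using deg_pos[of "flip c i"] by (metis One_nat_def Suc_1 Suc_leI le_neq_implies_less)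
  then have "(\<Sum>i\<in>UNIV. 1 / real (deg (flip c i))) \<le> (\<Sum>i\<in>(UNIV::'n set). 1 / 2)"
    by (intro sum_mono inverse_le_half)
  then show ?thesis using inverse_le_one[of "deg c"] by (simp add: share_eq)
next
  case False
  then obtain o' where o': "deg (flip c o') = 1" by blast
  have d: "deg c \<ge> 2" using False assms deg_pos[of c] by force
  have "deg (flip c i) \<ge> 2" if "i \<noteq> o'" for i
    using deg_pos[of "flip c i"] deg_flip_eq_1_unique[OF c o', of i] that by force
  then have "(\<Sum>i\<in>UNIV - {o'}. 1 / real (deg (flip c i))) \<le> (\<Sum>i\<in>UNIV - {o'}. 1 / 2)"
    by (intro sum_mono inverse_le_half) auto
  also have "\<dots> = (real CARD('n) - 1) / 2"
    by (simp add: card_Diff_singleton of_nat_diff Suc_leI)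
  finally have "(\<Sum>i\<in>UNIV. 1 / real (deg (flip c i))) \<le> 1 + (real CARD('n) - 1) / 2"
    using o' by (simp add: sum.remove[of UNIV o'])
  then show ?thesis using inverse_le_half[OF d] by (simp add: share_eq field_simps)
qed

end

section \<open>Isolated codewords with an orphan neighbour\<close>

locale isolated_with_orphan = ld_code C for C :: "'n::finite bword set" +
  fixes c :: "'n bword" and o' :: 'n
  assumes codeword: "c \<in> C" and deg_1: "deg c = 1" and deg_orphan: "deg (flip c o') = 1"
begin

definition F :: "'n set" where "F = {i. father C (flip c i)}"
definition S :: "'n set" where "S = {i. son C (flip c i)}"

lemma flip_notin: "flip c i \<notin> C"
proof -
  have "card {i. flip c i \<in> C} = 0" using codeword deg_1 by (simp add: card_I_set)
  then show ?thesis by auto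
qed

lemma flip_orphan_notin:
  assumes "i \<noteq> o'"
  shows "flip (flip c o') i \<notin> C"
proof
  assume "flip (flip c o') i \<in> C"
  then have "flip (flip c o') i \<in> I_set C (flip c o')" by (auto simp: I_set_eq)
  then show False using deg_flip_eq_1(1)[OF codeword deg_orphan] assms by simp
qed

lemma orphan_iff: "orphan C (flip c i) \<longleftrightarrow> i = o'"
  using deg_flip_eq_1_unique[OF codeword deg_orphan, of i] deg_orphan flip_notin
  by (auto simp: orphan_def)

text \<open>Two codewords at distance 2 have exactly two common neighbours, here
  \<open>flip c i\<close> and \<open>flip c j\<close>. The first sees only these two codewords, so
  separation forces a third one on the second.\<close>

lemma deg_2_obtain_father:
  assumes "deg (flip c i) = 2"
  obtains j where "j \<noteq> i" "j \<in> F" "flip (flip c j) i \<in> C" "i \<in> S"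
proof -
  have "card {j. flip (flip c i) j \<in> C} = 2"
    using assms flip_notin[of i] by (simp add: card_I_set)
  moreover have "i \<in> {j. flip (flip c i) j \<in> C}" using codeword by simp
  ultimately obtain j where j: "{j. flip (flip c i) j \<in> C} = {i, j}" "j \<noteq> i"
    by (metis (no_types, lifting) card_2_iff doubleton_eq_iff insertE singletonD)
  have I: "I_set C (flip c i) = {c, flip (flip c i) j}"
    using flip_notin[of i] j by (simp add: I_set_eq)
  have jC: "flip (flip c j) i \<in> C" using j flip_commute[of c i j] by auto
  have sub: "I_set C (flip c i) \<subseteq> I_set C (flip c j)"
    unfolding I using mem_I_set_flip[OF codeword, of j] jC
    by (auto simp: I_set_eq flip_commute[of c i j])
  moreover have "I_set C (flip c i) \<noteq> I_set C (flip c j)"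
    using separated[OF flip_notin flip_notin, of i j] j(2) by auto
  ultimately have "deg (flip c i) < deg (flip c j)" by (intro psubset_card_mono) auto
  then have "father C (flip c j)" using assms by (simp add: father_def)
  then show thesis using that j jC sub assms by (auto simp: F_def S_def son_def)
qed

text \<open>The value of \<open>deg\<close> at a neighbour decides its class: 1 for the unique
  orphan, 2 for a son by \<open>deg_2_obtain_father\<close>, at least 3 for a father.\<close>

lemma directions: "UNIV = insert o' (F \<union> S)" "o' \<notin> F" "o' \<notin> S" "F \<inter> S = {}"
proof -
  show "UNIV = insert o' (F \<union> S)"
  proof (intro equalityI subsetI)
    fix i
    consider "deg (flip c i) = 1" | "deg (flip c i) = 2" | "deg (flip c i) \<ge> 3"
      using deg_pos[of "flip c i"] by linarith
    then show "i \<in> insert o' (F \<union> S)"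
    proof cases
      case 1
      then show ?thesis using deg_flip_eq_1_unique[OF codeword deg_orphan] by auto
    next
      case 2
      then show ?thesis by (auto elim: deg_2_obtain_father)
    qed (simp add: F_def father_def)
  qed simp
qed (use deg_orphan in \<open>auto simp: F_def S_def father_def son_def\<close>)

lemma card_S: "card F + card S + 1 = CARD('n)"
proof -
  have "CARD('n) = card (insert o' (F \<union> S))" using directions(1) by simp
  also have "\<dots> = 1 + card (F \<union> S)" using directions(2,3) by simp
  also have "card (F \<union> S) = card F + card S"
    using directions by (intro card_Un_disjoint) auto
  finally show ?thesis by simp
qed

text \<open>Each son direction \<open>i\<close> is charged to a father direction \<open>j\<close>
  through the codeword \<open>flip (flip c j) i\<close>; besides \<open>c\<close>, that father sees
  \<open>deg (flip c j) - 1\<close> codewords.\<close>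

lemma card_S_le: "card S \<le> (\<Sum>j\<in>F. deg (flip c j) - 1)"
proof -
  have "S \<subseteq> (\<Union>j\<in>F. {i. flip (flip c j) i \<in> C} - {j})"
  proof
    fix i assume "i \<in> S"
    then have "deg (flip c i) = 2" by (simp add: S_def son_def)
    then obtain j where "j \<noteq> i" "j \<in> F" "flip (flip c j) i \<in> C"
      by (auto elim: deg_2_obtain_father)
    then show "i \<in> (\<Union>j\<in>F. {i. flip (flip c j) i \<in> C} - {j})" by blast
  qed
  then have "card S \<le> card (\<Union>j\<in>F. {i. flip (flip c j) i \<in> C} - {j})"
    by (intro card_mono) auto
  also have "\<dots> \<le> (\<Sum>j\<in>F. card ({i. flip (flip c j) i \<in> C} - {j}))"
    by (intro card_UN_le) auto
  also have "\<dots> = (\<Sum>j\<in>F. deg (flip c j) - 1)"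
    using flip_notin codeword by (intro sum.cong) (auto simp: card_I_set card_Diff_singleton)
  finally show ?thesis .
qed

text \<open>The 2 collects \<open>c\<close> and the orphan, each contributing 1; every son
  contributes 1/2.\<close>

lemma share_eq_fathers:
  "share C c = 2 + real (card S) / 2 + (\<Sum>j\<in>F. 1 / real (deg (flip c j)))"
proof -
  have "(\<Sum>i\<in>UNIV. 1 / real (deg (flip c i))) =
      1 / real (deg (flip c o')) + (\<Sum>i\<in>F \<union> S. 1 / real (deg (flip c i)))"
    using directions(2,3) by (subst directions(1)) simp
  also have "(\<Sum>i\<in>F \<union> S. 1 / real (deg (flip c i))) =
      (\<Sum>i\<in>F. 1 / real (deg (flip c i))) + (\<Sum>i\<in>S. 1 / real (deg (flip c i)))"
    using directions by (intro sum.union_disjoint) auto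
  also have "(\<Sum>i\<in>S. 1 / real (deg (flip c i))) = (\<Sum>i\<in>S. 1 / 2)"
    by (intro sum.cong) (auto simp: S_def son_def)
  finally show ?thesis using deg_1 deg_orphan by (simp add: share_eq)
qed

lemma card_F_neq_0:
  assumes "CARD('n) \<ge> 2"
  shows "card F \<noteq> 0"
proof
  assume "card F = 0"
  then have "card S = 0" using card_S_le by simp
  with \<open>card F = 0\<close> card_S assms show False by simp
qed

text \<open>Isolation and uniqueness of the orphan hold throughout this locale, so only the number
  of sons remains to be compared, by means of \<open>card_S\<close>.\<close>

lemma special_iff:
  assumes "CARD('n) \<ge> 10"
  shows "special_codeword C c \<longleftrightarrow> card F = 1"
proof -
  have "I_set C c = {c}" using codeword flip_notin by (simp add: I_set_singleton_iff)
  moreover have "card {x \<in> nbhd c. orphan C x} = 1"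
    by (simp add: card_nbhd_Collect orphan_iff)
  moreover have "card {x \<in> nbhd c. son C x} = card S"
    by (simp add: card_nbhd_Collect S_def)
  moreover have "card S = CARD('n) - 2 \<longleftrightarrow> card F = 1" using card_S assms by linarith
  ultimately show ?thesis using codeword by (simp add: special_codeword_def)
qed

lemma share_le_if_two_fathers:
  assumes n: "CARD('n) \<ge> 10" and F1: "card F \<noteq> 1"
  shows "share C c \<le> real CARD('n) / 2 + 1"
proof -
  have F3: "deg (flip c j) \<ge> 3" if "j \<in> F" for j
    using that by (simp add: F_def father_def)
  \<comment> \<open>By \<open>share_eq_fathers\<close> and \<open>card_S\<close> this is the desired
    bound rewritten.\<close>
  have "(\<Sum>j\<in>F. 1 / real (deg (flip c j))) \<le> (real (card F) - 1) / 2"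
  proof (cases "card F = 2")
    case True
    then obtain j k where jk: "F = {j, k}" "j \<noteq> k" by (auto simp: card_2_iff)
    define a b where "a = deg (flip c j)" and "b = deg (flip c k)"
    have ab: "a \<ge> 3" "b \<ge> 3" using F3 jk by (auto simp: a_def b_def)
    have "card S \<le> (a - 1) + (b - 1)" using card_S_le jk by (simp add: a_def b_def)
    \<comment> \<open>Two fathers leave \<open>CARD('n) - 3\<close> sons, at least 7, and can serve
      at most \<open>a + b - 2\<close> of them.\<close>
    then have "a + b \<ge> 9" using card_S True n ab by linarith
    \<comment> \<open>\<open>(a - 2)(b - 2) - 4 = (a - 3)(b - 3) + (a + b - 9)\<close>, and \<open>1/a + 1/b \<le> 1/2\<close>
      amounts to \<open>(a - 2)(b - 2) \<ge> 4\<close>.\<close>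
    moreover have "(real a - 3) * (real b - 3) \<ge> 0" using ab by simp
    ultimately have "2 * (real a + real b) \<le> real a * real b" by (simp add: algebra_simps)
    then have "1 / real a + 1 / real b \<le> 1 / 2" using ab by (simp add: field_simps)
    then show ?thesis using jk True by (simp add: a_def b_def)
  next
    case False
    then have k: "card F \<ge> 3" using F1 card_F_neq_0 n by linarith
    \<comment> \<open>For k fathers, k/3 \<le> (k - 1)/2 holds exactly when k \<ge> 3.\<close>
    have "(\<Sum>j\<in>F. 1 / real (deg (flip c j))) \<le> (\<Sum>j\<in>F. 1 / 3)"
    proof (intro sum_mono)
      fix j assume "j \<in> F"
      then show "1 / real (deg (flip c j)) \<le> 1 / 3"
        using F3[of j] by (intro divide_left_mono) auto
    qed
    then show ?thesis using k by simp
  qed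
  moreover have "real (card S) = real CARD('n) - 1 - real (card F)" using card_S by linarith
  ultimately show ?thesis by (simp add: share_eq_fathers field_simps)
qed

end

section \<open>Special codewords, special fathers and the averaging\<close>

context ld_code
begin

lemma special_imp_isolated:
  assumes "special_codeword C c"
  obtains o' where "isolated_with_orphan C c o'"
proof -
  have "card {i. orphan C (flip c i)} = 1"
    using assms card_nbhd_Collect[of c "orphan C"] by (simp add: special_codeword_def)
  then obtain o' where "orphan C (flip c o')" by (auto simp: card_1_singleton_iff)
  then have "isolated_with_orphan C c o'"
    using assms by unfold_locales (auto simp: special_codeword_def orphan_def)
  then show thesis by (rule that)
qed

lemma share_le_if_not_special:
  assumes "CARD('n) \<ge> 10" "c \<in> C" "\<not> special_codeword C c"
  shows "share C c \<le> real CARD('n) / 2 + 1"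
proof (cases "deg c \<noteq> 1 \<or> (\<forall>i. deg (flip c i) \<noteq> 1)")
  case True
  then show ?thesis using share_le_if_not_both assms by blast
next
  case False
  then obtain o' where o': "deg c = 1" "deg (flip c o') = 1" by blast
  interpret isolated_with_orphan C c o' using assms o' by unfold_locales
  show ?thesis using share_le_if_two_fathers special_iff assms by blast
qed

text \<open>A lone father must serve all n - 2 sons, so together with \<open>c\<close> it sees at
  least n - 1 codewords; the missing direction \<open>o'\<close> is that of the orphan. The excess
  over the bound is the father's own term.\<close>

lemma special_structure:
  assumes n: "CARD('n) \<ge> 10" and sp: "special_codeword C c"
  obtains j o' where "{i. father C (flip c i)} = {j}"
    "share C c = real CARD('n) / 2 + 1 + 1 / real (deg (flip c j))"
    "flip c j \<notin> C" "\<And>i. flip (flip c j) i \<in> C \<longleftrightarrow> i \<noteq> o'"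
    "deg c = 1"
proof -
  obtain o' where "isolated_with_orphan C c o'" using sp by (rule special_imp_isolated)
  then interpret isolated_with_orphan C c o' .
  have "card F = 1" using sp special_iff n by blast
  then obtain j where j: "F = {j}" by (auto simp: card_1_singleton_iff)
  have cS: "card S + 2 = CARD('n)" using card_S j by simp
  have share: "share C c = real CARD('n) / 2 + 1 + 1 / real (deg (flip c j))"
    using share_eq_fathers j cS by (simp add: field_simps flip: cS)
  let ?D = "{i. flip (flip c j) i \<in> C}"
  have jo: "j \<noteq> o'" using directions j by auto
  have "deg (flip c j) = card ?D" using flip_notin by (simp add: card_I_set)
  moreover have "card S \<le> deg (flip c j) - 1" using card_S_le j by simp
  ultimately have "card (UNIV - {o'}) \<le> card ?D" using cS n by (simp add: card_Diff_singleton)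
  \<comment> \<open>A codeword in direction \<open>o'\<close> from the father would be a second
    codeword next to the orphan \<open>flip c o'\<close>.\<close>
  moreover have sub: "?D \<subseteq> UNIV - {o'}"
    using flip_orphan_notin[OF jo] flip_commute[of c j o'] by auto
  ultimately have "?D = UNIV - {o'}" by (intro card_seteq) auto
  then have "flip (flip c j) i \<in> C \<longleftrightarrow> i \<noteq> o'" for i by blast
  then show thesis using that[of j o'] j share flip_notin deg_1 by (simp add: F_def)
qed

text \<open>This is \<open>special_structure\<close> seen from the father: a special codeword has
  only one neighbouring father, so \<open>u\<close> is the one described there.\<close>

lemma special_father_obtain:
  assumes n: "CARD('n) \<ge> 10" and "special_father C u"
  obtains j o' where "special_codeword C (flip u j)" "u \<notin> C"
    "\<And>i. flip u i \<in> C \<longleftrightarrow> i \<noteq> o'"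
proof -
  obtain c where c: "special_codeword C c" "u \<in> nbhd c" and u: "father C u"
    using assms by (auto simp: special_father_def)
  then obtain k where k: "u = flip c k" by (auto simp: nbhd_eq_range_flip)
  obtain j o' where *: "{i. father C (flip c i)} = {j}" "flip c j \<notin> C"
    "\<And>i. flip (flip c j) i \<in> C \<longleftrightarrow> i \<noteq> o'"
    using special_structure[OF n c(1)] by metis
  have "k = j" using * u k by blast
  then have "c = flip u j" "u = flip c j" using k by simp_all
  then show thesis using that[of j o'] * c by metis
qed

lemma special_unique_father:
  assumes "CARD('n) \<ge> 10" "special_codeword C c" "father C (flip c i)" "father C (flip c j)"
  shows "i = j"
  using special_structure[OF assms(1,2)] assms(3,4) by (metis (mono_tags) mem_Collect_eq singletonD)

text \<open>Ensures that codewords outside all averages are not special. The only father next to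
  \<open>c\<close> is \<open>flip c j\<close>, and \<open>c\<close> itself is none because
  \<open>deg c = 1\<close>.\<close>

lemma special_in_C':
  assumes n: "CARD('n) \<ge> 10" and sp: "special_codeword C c"
  obtains u where "special_father C u" "c \<in> C' C u"
proof -
  obtain j where j: "{i. father C (flip c i)} = {j}" "deg c = 1"
    using special_structure[OF n sp] by metis
  have c: "c \<in> C" using sp by (simp add: special_codeword_def)
  have sf: "special_father C (flip c i) \<longleftrightarrow> i = j" for i
    using j sp by (auto simp: special_father_def nbhd_eq_range_flip set_eq_iff)
  moreover have "\<not> special_father C c" using j by (simp add: special_father_def father_def)
  ultimately have "{w \<in> closed_nbhd c. special_father C w} = {flip c j}"
    by (auto simp: closed_nbhd_def nbhd_eq_range_flip)
  then have "c \<in> C' C (flip c j)" using mem_I_set_flip[OF c] by (simp add: C'_def)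
  then show thesis using that sf by blast
qed

text \<open>The only non-codeword neighbour \<open>flip u o'\<close> of \<open>u\<close> needs a
  dominating codeword \<open>flip (flip u o') i\<close>, whose other common neighbour with
  \<open>u\<close> is \<open>a = flip u i\<close>. Each of the n words of \<open>N[a]\<close> other
  than \<open>u\<close> then sees at least two codewords.\<close>

lemma compensating_codeword:
  assumes n: "CARD('n) \<ge> 10" and u: "special_father C u"
  obtains a where "a \<in> C' C u" "share C a \<le> real CARD('n) / 2 + 1 / real (deg u)"
proof -
  obtain o' where uC: "u \<notin> C" and D: "\<And>i. flip u i \<in> C \<longleftrightarrow> i \<noteq> o'"
    using special_father_obtain[OF n u] by metis
  have fu: "father C u" using u by (simp add: special_father_def)
  have "I_set C (flip u o') \<noteq> {}" using ld by (simp add: locating_dominating_def)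
  then obtain i where i: "flip (flip u o') i \<in> C" using D[of o'] by (auto simp: I_set_eq)
  have io: "i \<noteq> o'" using i uC by auto
  define a where "a = flip u i"
  have aC: "a \<in> C" using D io by (simp add: a_def)
  have bC: "flip a o' \<in> C" using i by (simp add: a_def flip_commute)
  have ua: "flip a i = u" by (simp add: a_def)
  \<comment> \<open>In direction \<open>o'\<close> the neighbour is itself a codeword next to
    \<open>a\<close>; in any other direction \<open>k\<close> it completes the square on
    \<open>u\<close>, \<open>a\<close> and the codeword \<open>flip u k\<close>.\<close>
  have deg2: "deg (flip a k) \<ge> 2" if "k \<noteq> i" for k
  proof (cases "k = o'")
    case True
    then show ?thesis using deg_ge_2[of a "flip a o'" "flip a o'"] mem_I_set_flip[OF aC, of o'] bC
      by (simp add: I_set_eq)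
  next
    case False
    then have "flip u k \<in> I_set C (flip a k)"
      using mem_I_set_flip[of "flip u k" i] D by (simp add: a_def flip_commute)
    then show ?thesis using deg_ge_2[of a] mem_I_set_flip[OF aC, of k] that
      by (auto simp: a_def)
  qed
  have dega: "deg a \<ge> 2"
    using deg_ge_2[of a a "flip a o'"] aC bC by (simp add: I_set_eq)
  have "(\<Sum>k\<in>UNIV - {i}. 1 / real (deg (flip a k))) \<le> (\<Sum>k\<in>UNIV - {i}. 1 / 2)"
    using deg2 by (intro sum_mono inverse_le_half) auto
  also have "\<dots> = (real CARD('n) - 1) / 2"
    by (simp add: card_Diff_singleton of_nat_diff Suc_leI)
  finally have "(\<Sum>k\<in>UNIV. 1 / real (deg (flip a k))) \<le> 1 / real (deg u) + (real CARD('n) - 1) / 2"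
    using ua by (simp add: sum.remove[of UNIV i])
  then have share: "share C a \<le> real CARD('n) / 2 + 1 / real (deg u)"
    using inverse_le_half[OF dega] by (simp add: share_eq field_simps)
  have notsf: "v \<notin> C" if "special_father C v" for v
    using special_father_obtain[OF n that] by metis
  \<comment> \<open>Let \<open>z\<close> be a special codeword next to another special father
    \<open>flip a k\<close>, in direction \<open>l\<close> from it. If \<open>l\<close> is
    \<open>k\<close> or \<open>o'\<close>, then \<open>z\<close> has a codeword neighbour; otherwise
    \<open>flip z k\<close> is a second father next to \<open>z\<close>. Both are
    impossible.\<close>
  have only: "k = i" if sf: "special_father C (flip a k)" for k
  proof (rule ccontr)
    assume ki: "k \<noteq> i"
    have ko: "k \<noteq> o'" using notsf[OF sf] bC by auto
    have fv: "father C (flip a k)" using sf by (simp add: special_father_def)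
    obtain l where l: "special_codeword C (flip (flip a k) l)"
      using special_father_obtain[OF n sf] by metis
    define z where "z = flip (flip a k) l"
    have zsp: "special_codeword C z" using l by (simp add: z_def)
    have zC: "z \<in> C" and ziso: "flip z m \<notin> C" for m
      using zsp I_set_singleton_iff[of z C] by (auto simp: special_codeword_def)
    have fz: "father C (flip z l)" using fv by (simp add: z_def)
    consider "l = k" | "l = i" | "l = o'" | "l \<noteq> k" "l \<noteq> i" "l \<noteq> o'" by blast
    then show False
    proof cases
      case 1
      then show ?thesis using ziso[of o'] bC by (simp add: z_def)
    next
      case 2
      then have "z = flip u k" by (simp add: z_def a_def flip_commute[of u i k])
      then have "father C (flip z k)" using fu by simp
      then show ?thesis using special_unique_father[OF n zsp fz] 2 ki by blast
    next
      case 3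
      then have "flip z k = flip a o'" by (simp add: z_def flip_commute[of a k o'])
      then show ?thesis using ziso[of k] bC by simp
    next
      case 4
      \<comment> \<open>The word \<open>flip z k\<close> is adjacent to the three codewords
        \<open>a\<close>, \<open>z\<close> and \<open>flip u l\<close>.\<close>
      have zk: "flip z k = flip a l" by (simp add: z_def flip_commute[of a k l])
      have "a \<in> I_set C (flip z k)" using zk mem_I_set_flip[OF aC] by simp
      moreover have "z \<in> I_set C (flip z k)" using mem_I_set_flip[OF zC] .
      moreover have "flip u l \<in> I_set C (flip z k)"
        using mem_I_set_flip[of "flip u l" i] D 4 by (simp add: zk a_def flip_commute[of u i l])
      moreover have "a \<noteq> z" using 4 by (metis flip_flip_eq_iff z_def)
      moreover have "a \<noteq> flip u l" using 4 by (simp add: a_def)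
      moreover have "z \<noteq> flip u l"
      proof
        assume "z = flip u l"
        then have "flip z l = u" by simp
        moreover have "flip z l = flip a k" by (simp add: z_def)
        ultimately show False using ua ki by (metis flip_eq_iff)
      qed
      ultimately have "father C (flip z k)" unfolding father_def by (rule deg_ge_3)
      then show ?thesis using special_unique_father[OF n zsp fz] 4 by blast
    qed
  qed
  have "{w \<in> closed_nbhd a. special_father C w} = {u}"
    using only u ua notsf[of a] aC by (auto simp: closed_nbhd_def nbhd_eq_range_flip)
  moreover have "a \<in> I_set C u" using mem_I_set_flip[OF aC, of i] ua by simp
  ultimately have "a \<in> C' C u" by (simp add: C'_def)
  then show thesis using that share by blast
qed

text \<open>Let m be \<open>deg u\<close> and k the size of \<open>C' C u\<close>. Each share
  exceeds the bound by at most 1/m, and that of \<open>b\<close> falls short by at least 1 - 1/m, so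
  the total excess is at most k/m - 1. This is not positive, since \<open>C' C u\<close> lies inside
  \<open>I_set C u\<close>.\<close>

lemma average_le:
  assumes n: "CARD('n) \<ge> 10" and u: "special_father C u"
  shows "(\<Sum>a\<in>C' C u. share C a) / real (card (C' C u)) \<le> real CARD('n) / 2 + 1"
proof -
  obtain b where b: "b \<in> C' C u" "share C b \<le> real CARD('n) / 2 + 1 / real (deg u)"
    using compensating_codeword[OF n u] by metis
  have uC: "u \<notin> C" using special_father_obtain[OF n u] by metis
  have fu: "father C u" using u by (simp add: special_father_def)
  let ?B = "real CARD('n) / 2 + 1" and ?m = "real (deg u)" and ?k = "real (card (C' C u))"
  have m: "?m > 0" using deg_pos[of u] by simp
  have le: "share C a \<le> ?B + 1 / ?m" if a: "a \<in> C' C u" for a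
  proof (cases "special_codeword C a")
    case True
    obtain i where i: "a = flip u i"
      using a uC by (auto simp: C'_def I_set_eq)
    obtain j where j: "{i. father C (flip a i)} = {j}"
      "share C a = ?B + 1 / real (deg (flip a j))"
      using special_structure[OF n True] by metis
    \<comment> \<open>Here \<open>flip a i\<close> is \<open>u\<close>, so the unique father next to
      \<open>a\<close> is \<open>u\<close> and the excess is governed by
      \<open>deg u\<close>.\<close>
    have "father C (flip a i)" using i fu by simp
    then have "i = j" using j(1) by blast
    then show ?thesis using j i by simp
  next
    case False
    have "a \<in> C" using a by (auto simp: C'_def I_set_def)
    then have "share C a \<le> ?B" using share_le_if_not_special n False by blast
    then show ?thesis using m by (smt (verit) divide_nonneg_pos)
  qed
  have fin: "finite (C' C u)" by simp
  have "card (C' C u) \<le> deg u" by (intro card_mono) (auto simp: C'_def)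
  then have km: "?k \<le> ?m" by simp
  have k: "?k \<ge> 1" using b fin by (auto simp: Suc_le_eq card_gt_0_iff)
  have "(\<Sum>a\<in>C' C u. share C a) = share C b + (\<Sum>a\<in>C' C u - {b}. share C a)"
    using b by (intro sum.remove) auto
  also have "(\<Sum>a\<in>C' C u - {b}. share C a) \<le> (\<Sum>a\<in>C' C u - {b}. ?B + 1 / ?m)"
    using le by (intro sum_mono) auto
  also have "\<dots> = (?k - 1) * (?B + 1 / ?m)"
    using b k by (simp add: card_Diff_singleton of_nat_diff)
  also have "share C b + \<dots> \<le> (?B - 1 + 1 / ?m) + (?k - 1) * (?B + 1 / ?m)"
    using b by simp
  also have "\<dots> = ?k * ?B + (?k / ?m - 1)" by (simp add: algebra_simps diff_divide_distrib)
  also have "\<dots> \<le> ?k * ?B" using km m by simp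
  finally show ?thesis using k by (simp add: field_simps)
qed

end

theorem theorem5:
  fixes C :: "'n::finite bword set" and c :: "'n bword"
  assumes "CARD('n) \<ge> 10"
    and "locating_dominating C"
    and "c \<in> C"
  shows "share_rule1 C c \<le> real CARD('n) / 2 + 1"
proof -
  interpret ld_code C using assms by unfold_locales
  show ?thesis
  proof (cases "\<exists>u. special_father C u \<and> c \<in> C' C u")
    case True
    then obtain u where u: "special_father C u" "c \<in> C' C u" by blast
    then show ?thesis using share_rule1_average[OF u] average_le[OF assms(1) u(1)] by simp
  next
    case False
    \<comment> \<open>A special codeword would lie in some \<open>C' C u\<close>; hence the
      unchanged share already obeys the bound.\<close>
    then have "\<not> special_codeword C c" using special_in_C'[OF assms(1)] by metis
    moreover have "share_rule1 C c = share C c" using False by (intro share_rule1_unchanged) blast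
    ultimately show ?thesis using share_le_if_not_special assms by simp
  qed
qed

end
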